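(* Let $\alpha\in\mathbb{R}$. For every integer $n\ge0$ and every $x\in\mathbb{R}$, $$\lim_{\omega\to0}P_n^{\left(\frac{\alpha+1}{2}\right)}\!\left(\frac{-x}{2\omega};\omega\right)=L_n^{(\alpha)}(x),$$ where $P_n^{(\lambda)}(\cdot\,;\omega)$ are the Meixner–Pollaczek polynomials and $L_n^{(\alpha)}$ the generalized Laguerre polynomials.
   Context: The Meixner–Pollaczek polynomials are defined by the generating function $(1-e^{i\omega}z)^{-\lambda+ix}(1-e^{-i\omega}z)^{-\lambda-ix}=\sum_{n=0}^\infty P_n^{(\lambda)}(x;\omega)z^n$ (with $\omega$ real, $|z|<1$, principal branches). The generalized Laguerre polynomials are defined by $(1-z)^{-\alpha-1}e^{-\frac{zx}{1-z}}=\sum_{n=0}^\infty L_n^{(\alpha)}(x)z^n$, $|z|<1$. *)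

theory Defs
  imports "HOL-Complex_Analysis.Complex_Analysis"
begin

(* For complex arguments powr is the principal branch.  For |z| < 1 every base below lies in
   the open right half plane, so no branch cut and no zero base is met. *)

definition meixner_pollaczek_gf :: "complex \<Rightarrow> complex \<Rightarrow> real \<Rightarrow> complex \<Rightarrow> complex" where
  "meixner_pollaczek_gf lam x \<omega> z =
     (1 - exp (\<i> * of_real \<omega>) * z) powr (- lam + \<i> * x) *
     (1 - exp (- \<i> * of_real \<omega>) * z) powr (- lam - \<i> * x)"

definition meixner_pollaczek :: "nat \<Rightarrow> complex \<Rightarrow> complex \<Rightarrow> real \<Rightarrow> complex" where
  "meixner_pollaczek n lam x \<omega> = fps_nth (fps_expansion (meixner_pollaczek_gf lam x \<omega>) 0) n"

definition laguerre_gf :: "complex \<Rightarrow> complex \<Rightarrow> complex \<Rightarrow> complex" where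
  "laguerre_gf \<alpha> x z = (1 - z) powr (- \<alpha> - 1) * exp (- (z * x / (1 - z)))"

definition laguerre :: "nat \<Rightarrow> complex \<Rightarrow> complex \<Rightarrow> complex" where
  "laguerre n \<alpha> x = fps_nth (fps_expansion (laguerre_gf \<alpha> x) 0) n"

lemma gf_coefficients_iff:
  assumes "f holomorphic_on ball 0 1"
  shows "(\<forall>z. norm z < 1 \<longrightarrow> (\<lambda>n. a n * z ^ n) sums f z) \<longleftrightarrow>
         (\<forall>n. a n = fps_nth (fps_expansion f 0) n)"
    (is "?L \<longleftrightarrow> ?R")
proof
  assume ?L
  then have "eventually (\<lambda>z. (\<lambda>n. fps_nth (Abs_fps a) n * z ^ n) sums f z) (nhds 0)"
    unfolding eventually_nhds_metric by (intro exI[of _ 1]) (simp add: dist_norm)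
  then have "f has_fps_expansion Abs_fps a"
    by (rule has_fps_expansionI)
  then show ?R
    using fps_expansion_eqI by (metis fps_nth_Abs_fps)
next
  assume R: ?R
  show ?L
  proof (intro allI impI)
    fix z :: complex
    assume "norm z < 1"
    then show "(\<lambda>n. a n * z ^ n) sums f z"
      using holomorphic_power_series[OF assms, of z] R by (simp add: fps_expansion_def)
  qed
qed

lemma one_minus_notin_nonpos_Reals:
  assumes "norm (u :: complex) < 1"
  shows "1 - u \<notin> \<real>\<^sub>\<le>\<^sub>0"
proof -
  have "Re u < 1"
    using assms complex_Re_le_cmod[of u] by linarith
  then show ?thesis
    by (auto simp: complex_nonpos_Reals_iff)
qed

(* The defining generating-function identities on |z| < 1 hold, and determine the coefficients. *)

lemma meixner_pollaczek_iff:
  "(\<forall>z. norm z < 1 \<longrightarrow> (\<lambda>n. a n * z ^ n) sums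
        ((1 - exp (\<i> * of_real \<omega>) * z) powr (- lam + \<i> * x) *
         (1 - exp (- \<i> * of_real \<omega>) * z) powr (- lam - \<i> * x))) \<longleftrightarrow>
   (\<forall>n. a n = meixner_pollaczek n lam x \<omega>)"
proof -
  have "1 - exp (\<i> * of_real \<omega>) * z \<notin> \<real>\<^sub>\<le>\<^sub>0" "1 - exp (- \<i> * of_real \<omega>) * z \<notin> \<real>\<^sub>\<le>\<^sub>0"
    if "z \<in> ball 0 1" for z
    using that by (intro one_minus_notin_nonpos_Reals; simp add: norm_mult)+
  then have "meixner_pollaczek_gf lam x \<omega> holomorphic_on ball 0 1"
    unfolding meixner_pollaczek_gf_def[abs_def] by (intro holomorphic_intros) auto
  from gf_coefficients_iff[OF this] show ?thesis
    by (simp add: meixner_pollaczek_def meixner_pollaczek_gf_def)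
qed

lemma laguerre_iff:
  "(\<forall>z. norm z < 1 \<longrightarrow> (\<lambda>n. a n * z ^ n) sums
        ((1 - z) powr (- \<alpha> - 1) * exp (- (z * x / (1 - z))))) \<longleftrightarrow>
   (\<forall>n. a n = laguerre n \<alpha> x)"
proof -
  have "1 - z \<notin> \<real>\<^sub>\<le>\<^sub>0" if "z \<in> ball 0 1" for z :: complex
    using that by (intro one_minus_notin_nonpos_Reals) simp
  then have "laguerre_gf \<alpha> x holomorphic_on ball 0 1"
    unfolding laguerre_gf_def[abs_def] by (intro holomorphic_intros) auto
  from gf_coefficients_iff[OF this] show ?thesis
    by (simp add: laguerre_def laguerre_gf_def)
qed

end

theory Submission
  imports Defs
begin

text \<open>
  Both generating functions satisfy the same kind of linear differential equation
  \<open>(1 - 2 c z + z\<^sup>2) f' = (a - b z) f\<close> with \<open>f 0 = 1\<close>. Logarithmic differentiation gives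
  \<open>c = cos \<omega>\<close>, \<open>a = 2 \<lambda> cos \<omega> + 2 x sin \<omega>\<close>, \<open>b = 2 \<lambda>\<close> in the Meixner--Pollaczek case
  (\<open>meixner_pollaczek_fps_ode\<close>) and \<open>c = 1\<close>, \<open>a = \<alpha> + 1 - x\<close>, \<open>b = \<alpha> + 1\<close> in the Laguerre case
  (\<open>laguerre_fps_ode\<close>). With \<open>\<lambda> = (\<alpha> + 1) / 2\<close> and \<open>x\<close> replaced by \<open>- x / (2 \<omega>)\<close>, the first
  triple becomes \<open>(cos \<omega>, (\<alpha> + 1) cos \<omega> - x sin \<omega> / \<omega>, \<alpha> + 1)\<close>, which tends to the second
  as \<open>\<omega> \<rightarrow> 0\<close>.

  Such an equation amounts to a recurrence that computes each Taylor coefficient of \<open>f\<close> from the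
  earlier ones, continuously in \<open>(c, a, b)\<close>. Hence the coefficients converge, by induction on
  the index (\<open>tendsto_fps_nth_log_deriv\<close>).
\<close>

text \<open>
  Reading off the coefficient of \<open>X\<^sup>m\<close> in \<open>P F' = Q F\<close>, where \<open>P\<close> has constant term 1, isolates
  \<open>(m + 1) F\<^sub>m\<^sub>+\<^sub>1\<close> as a polynomial in coefficients of \<open>P\<close> and \<open>Q\<close> and in earlier coefficients of
  \<open>F\<close>. So coefficientwise convergence of \<open>P\<close> and \<open>Q\<close> carries over to the solution.
\<close>
lemma tendsto_fps_nth_log_deriv:
  fixes P Q F :: "'b \<Rightarrow> 'a :: real_normed_field fps" and P' Q' F' :: "'a fps"
  assumes ode: "\<And>w. P w * fps_deriv (F w) = Q w * F w" "P' * fps_deriv F' = Q' * F'"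
    and norm: "\<And>w. fps_nth (P w) 0 = 1" "fps_nth P' 0 = 1"
    and init: "((\<lambda>w. fps_nth (F w) 0) \<longlongrightarrow> fps_nth F' 0) A"
    and P: "\<And>n. ((\<lambda>w. fps_nth (P w) n) \<longlongrightarrow> fps_nth P' n) A"
    and Q: "\<And>n. ((\<lambda>w. fps_nth (Q w) n) \<longlongrightarrow> fps_nth Q' n) A"
  shows "((\<lambda>w. fps_nth (F w) n) \<longlongrightarrow> fps_nth F' n) A"
proof (induction n rule: less_induct)
  case (less n)
  show ?case
  proof (cases n)
    case 0
    with init show ?thesis by simp
  next
    case (Suc m)
    have solve: "fps_nth f (Suc m) =
        ((\<Sum>i=0..m. fps_nth q i * fps_nth f (m - i)) -
         (\<Sum>i=Suc 0..m. fps_nth p i * (of_nat (Suc (m - i)) * fps_nth f (Suc (m - i))))) / of_nat (Suc m)"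
      if eq: "p * fps_deriv f = q * f" and p0: "fps_nth p 0 = 1" for p q f :: "'a fps"
    proof -
      have "(\<Sum>i=0..m. fps_nth p i * fps_nth (fps_deriv f) (m - i)) =
            (\<Sum>i=0..m. fps_nth q i * fps_nth f (m - i))"
        using arg_cong[OF eq, of "\<lambda>g. fps_nth g m"] by (simp add: fps_mult_nth)
      moreover have "(\<Sum>i=0..m. fps_nth p i * fps_nth (fps_deriv f) (m - i)) =
          of_nat (Suc m) * fps_nth f (Suc m) +
          (\<Sum>i=Suc 0..m. fps_nth p i * (of_nat (Suc (m - i)) * fps_nth f (Suc (m - i))))"
        by (subst sum.atLeast_Suc_atMost) (simp_all add: p0)
      ultimately show ?thesis
        by (simp add: eq_divide_eq algebra_simps del: of_nat_Suc)
    qed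
    show ?thesis
      unfolding Suc solve[OF ode(1) norm(1)] solve[OF ode(2) norm(2)]
      by (intro tendsto_intros P Q less) (use Suc in \<open>auto simp del: of_nat_Suc\<close>)
  qed
qed

text \<open>
  The passage from functions to formal power series: both sides of the differential equation
  have a power series expansion at 0, and expansions are unique.
\<close>
lemma fps_ode_of_has_field_derivative:
  fixes f :: "complex \<Rightarrow> complex"
  assumes deriv: "\<And>z. norm z < 1 \<Longrightarrow> (f has_field_derivative f' z) (at z)"
    and ode: "\<And>z. norm z < 1 \<Longrightarrow> p z * f' z = q z * f z"
    and p: "p has_fps_expansion P" and q: "q has_fps_expansion Q"
  shows "P * fps_deriv (fps_expansion f 0) = Q * fps_expansion f 0"
proof -
  have "f holomorphic_on ball 0 1"
    by (subst holomorphic_on_open) (auto intro!: exI deriv)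
  then have f: "f has_fps_expansion fps_expansion f 0"
    by (intro has_fps_expansion_fps_expansion[of "ball 0 1"]) auto
  have "\<forall>\<^sub>F z in nhds 0. z \<in> ball (0 :: complex) 1"
    by (intro eventually_nhds_in_open) auto
  then have "\<forall>\<^sub>F z in nhds 0. p z * deriv f z = q z * f z"
    by eventually_elim (simp add: DERIV_imp_deriv[OF deriv] ode)
  moreover have "(\<lambda>z. p z * deriv f z) has_fps_expansion P * fps_deriv (fps_expansion f 0)"
    by (intro fps_expansion_intros f p)
  ultimately have "(\<lambda>z. q z * f z) has_fps_expansion P * fps_deriv (fps_expansion f 0)"
    by (subst (asm) has_fps_expansion_cong) auto
  moreover have "(\<lambda>z. q z * f z) has_fps_expansion Q * fps_expansion f 0"
    by (intro fps_expansion_intros f q)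
  ultimately show ?thesis
    by (metis fps_expansion_eqI)
qed

text \<open>
  The derivative is given as a multiple of the function itself, so that the logarithmic
  derivative of a product of such powers is read off as a sum.
\<close>
lemma has_field_derivative_linear_powr:
  fixes u z s :: complex
  assumes "norm (u * z) < 1"
  shows "((\<lambda>z. (1 - u * z) powr s) has_field_derivative
           (1 - u * z) powr s * (- s * u / (1 - u * z))) (at z)"
proof -
  note nonpos = one_minus_notin_nonpos_Reals[OF assms]
  then have "1 - u * z \<noteq> 0"
    by auto
  with nonpos show ?thesis
    by (auto intro!: derivative_eq_intros simp: powr_diff)
qed

text \<open>
  The logarithmic derivative of the generating function is
  \<open>(\<lambda> - i x) u / (1 - u z) + (\<lambda> + i x) v / (1 - v z)\<close> with \<open>u = e\<^sup>i\<^sup>\<omega>\<close> and \<open>v = e\<^sup>-\<^sup>i\<^sup>\<omega>\<close>. Multiplying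
  by \<open>(1 - u z) (1 - v z) = 1 - 2 z cos \<omega> + z\<^sup>2\<close> clears both denominators.
\<close>
lemma meixner_pollaczek_fps_ode:
  fixes lam x :: complex and \<omega> :: real
  defines "F \<equiv> fps_expansion (meixner_pollaczek_gf lam x \<omega>) 0"
  shows "(1 - fps_const (2 * of_real (cos \<omega>)) * fps_X + fps_X ^ 2) * fps_deriv F =
         (fps_const (2 * lam * of_real (cos \<omega>) + 2 * x * of_real (sin \<omega>)) -
          fps_const (2 * lam) * fps_X) * F"
  unfolding F_def
proof (rule fps_ode_of_has_field_derivative)
  define u v where "u = exp (\<i> * of_real \<omega>)" and "v = exp (- \<i> * of_real \<omega>)"
  have uv: "u * v = 1"
    by (simp add: u_def v_def flip: exp_add)
  have u: "u = of_real (cos \<omega>) + \<i> * of_real (sin \<omega>)"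
   and v: "v = of_real (cos \<omega>) - \<i> * of_real (sin \<omega>)"
    by (simp_all add: u_def v_def exp_Euler exp_minus_Euler flip: cos_of_real sin_of_real)
  define h where "h = (\<lambda>z. (lam - \<i> * x) * u / (1 - u * z) + (lam + \<i> * x) * v / (1 - v * z))"
  fix z :: complex assume z: "norm z < 1"
  have uz: "norm (u * z) < 1" and vz: "norm (v * z) < 1"
    using z by (simp_all add: u_def v_def norm_mult)
  show "(meixner_pollaczek_gf lam x \<omega> has_field_derivative
          meixner_pollaczek_gf lam x \<omega> z * h z) (at z)"
    unfolding meixner_pollaczek_gf_def[abs_def] u_def[symmetric] v_def[symmetric] h_def
    by (rule derivative_eq_intros has_field_derivative_linear_powr uz vz)+
       (simp add: algebra_simps diff_divide_distrib add_divide_distrib)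
  have nz: "1 - u * z \<noteq> 0" "1 - v * z \<noteq> 0"
    using one_minus_notin_nonpos_Reals[OF uz] one_minus_notin_nonpos_Reals[OF vz] by auto
  have "1 - 2 * of_real (cos \<omega>) * z + z ^ 2 = (1 - u * z) * (1 - v * z)"
  proof -
    have "(1 - u * z) * (1 - v * z) = 1 - (u + v) * z + (u * v) * z ^ 2"
      by (simp add: algebra_simps power2_eq_square)
    then show ?thesis by (simp add: uv) (simp add: u v)
  qed
  moreover have "(1 - u * z) * (1 - v * z) * h z =
      (lam - \<i> * x) * u * (1 - v * z) + (lam + \<i> * x) * v * (1 - u * z)"
  proof -
    have "U * V * (A / U + B / V) = A * V + B * U" if "U \<noteq> 0" "V \<noteq> 0" for A B U V :: complex
      using that by (simp add: field_simps)
    from this[OF nz] show ?thesis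
      unfolding h_def .
  qed
  moreover have "\<dots> = lam * (u + v) - \<i> * x * (u - v) - 2 * lam * (u * v) * z"
    by (simp add: algebra_simps)
  moreover have "\<dots> = 2 * lam * of_real (cos \<omega>) + 2 * x * of_real (sin \<omega>) - 2 * lam * z"
    by (simp add: uv) (simp add: u v algebra_simps)
  ultimately show "(1 - 2 * of_real (cos \<omega>) * z + z ^ 2) * (meixner_pollaczek_gf lam x \<omega> z * h z) =
      (2 * lam * of_real (cos \<omega>) + 2 * x * of_real (sin \<omega>) - 2 * lam * z) *
        meixner_pollaczek_gf lam x \<omega> z"
    by (simp add: mult_ac)
qed (intro fps_expansion_intros)+

text \<open>
  Here the logarithmic derivative is \<open>(\<alpha> + 1) / (1 - z) - x / (1 - z)\<^sup>2\<close>. The left factor is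
  \<open>(1 - X)\<^sup>2\<close>, expanded so as to be visibly the case \<open>\<omega> = 0\<close> of the Meixner--Pollaczek one.
\<close>
lemma laguerre_fps_ode:
  fixes \<alpha> x :: complex
  defines "F \<equiv> fps_expansion (laguerre_gf \<alpha> x) 0"
  shows "(1 - fps_const 2 * fps_X + fps_X ^ 2) * fps_deriv F =
         (fps_const (\<alpha> + 1 - x) - fps_const (\<alpha> + 1) * fps_X) * F"
  unfolding F_def
proof (rule fps_ode_of_has_field_derivative)
  define h where "h = (\<lambda>z. (\<alpha> + 1) / (1 - z) - x / (1 - z) ^ 2)"
  fix z :: complex assume z: "norm z < 1"
  have nz: "1 - z \<noteq> 0"
    using z by auto
  have powr: "((\<lambda>z. (1 - z) powr (- \<alpha> - 1)) has_field_derivative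
          (1 - z) powr (- \<alpha> - 1) * ((\<alpha> + 1) / (1 - z))) (at z)"
    using has_field_derivative_linear_powr[of 1 z "- \<alpha> - 1"] z by (simp add: add.commute)
  have exp: "((\<lambda>z. exp (- (z * x / (1 - z)))) has_field_derivative
          exp (- (z * x / (1 - z))) * (- x / (1 - z) ^ 2)) (at z)"
    using nz by (auto intro!: derivative_eq_intros simp: divide_simps power2_eq_square)
               (simp add: algebra_simps)
  show "(laguerre_gf \<alpha> x has_field_derivative laguerre_gf \<alpha> x z * h z) (at z)"
    unfolding laguerre_gf_def[abs_def]
    by (rule DERIV_cong[OF DERIV_mult[OF powr exp]]) (simp add: h_def algebra_simps)
  have "(1 - z) ^ 2 * h z = \<alpha> + 1 - x - (\<alpha> + 1) * z"
  proof -
    have "w ^ 2 * (a / w - x / w ^ 2) = a * w - x" if "w \<noteq> 0" for a w :: complex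
      using that by (simp add: field_simps power2_eq_square)
    from this[OF nz, of "\<alpha> + 1"] show ?thesis
      unfolding h_def by (simp add: algebra_simps)
  qed
  then show "(1 - 2 * z + z ^ 2) * (laguerre_gf \<alpha> x z * h z) =
      (\<alpha> + 1 - x - (\<alpha> + 1) * z) * laguerre_gf \<alpha> x z"
    by (simp add: power2_diff mult_ac add_diff_eq diff_add_eq)
qed (intro fps_expansion_intros)+

theorem corollary5p2:
  fixes \<alpha> x :: real and n :: nat
  shows "((\<lambda>\<omega>::real. meixner_pollaczek n (of_real ((\<alpha> + 1) / 2)) (of_real (- x / (2 * \<omega>))) \<omega>)
           \<longlongrightarrow> laguerre n (of_real \<alpha>) (of_real x)) (at 0)"
  unfolding meixner_pollaczek_def laguerre_def
proof (rule tendsto_fps_nth_log_deriv[OF meixner_pollaczek_fps_ode laguerre_fps_ode])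
  have cos: "((\<lambda>\<omega>::real. complex_of_real (cos \<omega>)) \<longlongrightarrow> 1) (at 0)"
    by (auto intro!: tendsto_eq_intros)
  \<comment> \<open>The factor \<open>1 / \<omega>\<close> in the rescaled argument is absorbed by \<open>sin \<omega>\<close>.\<close>
  have "((\<lambda>\<omega>::real. complex_of_real (- x * (sin \<omega> / \<omega>))) \<longlongrightarrow> of_real (- x * 1)) (at 0)"
    using DERIV_sin[of "0 :: real"]
    by (intro tendsto_intros) (simp add: has_field_derivative_iff)
  moreover have "complex_of_real (- x * (sin \<omega> / \<omega>)) =
      2 * of_real (- x / (2 * \<omega>)) * of_real (sin \<omega>)" for \<omega>
    by simp
  ultimately have sin: "((\<lambda>\<omega>. 2 * complex_of_real (- x / (2 * \<omega>)) * of_real (sin \<omega>))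
      \<longlongrightarrow> - of_real x) (at 0)"
    by simp
  fix k
  show "((\<lambda>\<omega>::real. fps_nth (1 - fps_const (2 * complex_of_real (cos \<omega>)) * fps_X + fps_X ^ 2) k)
      \<longlongrightarrow> fps_nth (1 - fps_const 2 * fps_X + fps_X ^ 2) k) (at 0)"
    by (auto simp: fps_X_power_nth intro!: tendsto_eq_intros cos)
  have lam: "2 * complex_of_real ((\<alpha> + 1) / 2) = of_real \<alpha> + 1"
    by (simp add: field_simps)
  have "((\<lambda>\<omega>. 2 * complex_of_real ((\<alpha> + 1) / 2) * of_real (cos \<omega>) +
           2 * of_real (- x / (2 * \<omega>)) * of_real (sin \<omega>))
      \<longlongrightarrow> 2 * complex_of_real ((\<alpha> + 1) / 2) * 1 + - of_real x) (at 0)"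
    by (intro tendsto_add tendsto_mult tendsto_const cos sin)
  then show "((\<lambda>\<omega>. fps_nth (fps_const (2 * complex_of_real ((\<alpha> + 1) / 2) * of_real (cos \<omega>) +
              2 * of_real (- x / (2 * \<omega>)) * of_real (sin \<omega>)) -
            fps_const (2 * of_real ((\<alpha> + 1) / 2)) * fps_X) k)
      \<longlongrightarrow> fps_nth (fps_const (of_real \<alpha> + 1 - of_real x) -
            fps_const (of_real \<alpha> + 1) * fps_X) k) (at 0)"
    unfolding lam by (cases "k = 0") (auto simp: add_diff_eq add.commute)
qed (simp_all add: fps_expansion_def meixner_pollaczek_gf_def laguerre_gf_def)

end
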